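(* Assume the setting and assumptions A1–A4 described in the context. Consider the Composite Mirror Prox (CoMP) recurrence $$x_1=[u_1;v_1]\in X,\qquad y_\tau=[u'_\tau;v'_\tau]=P_{x_\tau}(\gamma_\tau F(x_\tau)),\qquad x_{\tau+1}=[u_{\tau+1};v_{\tau+1}]=P_{x_\tau}(\gamma_\tau F(y_\tau)),\qquad \tau=1,2,\dots$$ with stepsizes $\gamma_\tau>0$ satisfying, for $\tau=1,2,\dots$, $$\delta_\tau:=\gamma_\tau\langle F_u(u'_\tau)-F_u(u_\tau),u'_\tau-u_{\tau+1}\rangle-V_{u'_\tau}(u_{\tau+1})-V_{u_\tau}(u'_\tau)\le\gamma_\tau^2M^2.\qquad( * )$$ Then for every $t\ge 1$ the execution protocol $\mathcal I_t=\{y_\tau,F(y_\tau)\}_{\tau=1}^t$ admits the accuracy certificate $\lambda^t=\{\lambda^t_\tau=\gamma_\tau/\sum_{i=1}^t\gamma_i\}_{\tau=1}^t$ such that for every $X'\subset X$ $$\mathrm{Res}(X'\,|\,\mathcal I_t,\lambda^t)\le\frac{\Theta[X']+M^2\sum_{\tau=1}^t\gamma_\tau^2}{\sum_{\tau=1}^t\gamma_\tau},\qquad \Theta[X']=\sup_{[u;v]\in X'}V_{u_1}(u).$$ Moreover, relation $( * )$ is satisfied whenever $0<\gamma_\tau\le(\sqrt2L)^{-1}$, or, in the case $M=0$, whenever $0<\gamma_\tau\le L^{-1}$.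
   Context: Setting. $E_u,E_v$ are Euclidean spaces, $E=E_u\times E_v$, $U\subset E_u$ is a nonempty closed convex set and $X\subset E$ is a nonempty closed convex set; vectors of $E$ are written $x=[u;v]$ with $u\in E_u$, $v\in E_v$. A1: $E_u$ is equipped with a norm $\|\cdot\|$ with conjugate norm $\|\cdot\|_*$, and $U$ with a distance-generating function $\omega:U\to\mathbf R$, i.e. a continuously differentiable convex function, which is strongly convex with modulus 1 w.r.t. $\|\cdot\|$. The Bregman distance is $V_u(w)=\omega(w)-\omega(u)-\langle\omega'(u),w-u\rangle$ for $u,w\in U$. A2: $u\in U$ for every $[u;v]\in X$. A3: $F:X\to E$ is a vector field of the form $F(u,v)=[F_u(u);F_v]$ with $F_u(u)\in E_u$ (defined for $u\in U$) and a constant vector $F_v\in E_v$, and $\|F_u(u)-F_u(u')\|_*\le L\|u-u'\|+M$ for all $u,u'\in U$, with some finite $L,M\ge 0$. A4: the linear form $\langle F_v,v\rangle$ of $[u;v]$ is bounded from below on $X$ and coercive on $X$ w.r.t. $v$: whenever $[u_t;v_t]\in X$, $t=1,2,\dots$, is such that $\{u_t\}$ is bounded and $\|v_t\|_2\to\infty$, one has $\langle F_v,v_t\rangle\to\infty$. Prox-mapping: for $\xi=[\eta;\zeta]\in E$ and $x=[u;v]\in X$, $P_x(\xi)$ is a point of $\operatorname{Argmin}_{[s;w]\in X}\{\langle\eta,s\rangle+\langle\zeta,w\rangle+V_u(s)\}$ (any selected minimizer; under A1–A4 this set is nonempty when $\zeta=\gamma F_v$ with $\gamma>0$). A $t$-step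 execution protocol is a collection $\mathcal I_t=\{y_\tau,F(y_\tau)\}_{\tau=1}^t$ with $y_\tau\in X$; an accuracy certificate for it is a collection $\lambda^t=\{\lambda^t_\tau\}_{\tau=1}^t$ of nonnegative reals summing up to 1. The resolution on a nonempty $X'\subset X$ is $\mathrm{Res}(X'|\mathcal I_t,\lambda^t)=\sup_{x\in X'}\sum_{\tau=1}^t\lambda^t_\tau\langle F(y_\tau),y_\tau-x\rangle$. When $L=0$, $L^{-1}$ is understood as $+\infty$. *)

theory Defs
  imports "HOL-Analysis.Analysis"
begin

text \<open>An arbitrary norm on a real vector space, not the Euclidean \<^const>\<open>norm\<close>.\<close>

definition is_norm :: "('a::real_vector \<Rightarrow> real) \<Rightarrow> bool" where
  "is_norm N \<longleftrightarrow>
     (\<forall>x. N x \<ge> 0) \<and> (\<forall>x. N x = 0 \<longleftrightarrow> x = 0) \<and>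
     (\<forall>c x. N (c *\<^sub>R x) = \<bar>c\<bar> * N x) \<and> (\<forall>x y. N (x + y) \<le> N x + N y)"

definition conj_norm :: "('a::real_inner \<Rightarrow> real) \<Rightarrow> 'a \<Rightarrow> real" where
  "conj_norm N \<xi> = (SUP x\<in>{x. N x \<le> 1}. \<xi> \<bullet> x)"

text \<open>Strong convexity with modulus 1 is with respect to the norm \<open>N\<close>, not the Euclidean one.\<close>

definition strongly_convex_on :: "('a::real_vector \<Rightarrow> real) \<Rightarrow> 'a set \<Rightarrow> ('a \<Rightarrow> real) \<Rightarrow> bool" where
  "strongly_convex_on N U \<omega> \<longleftrightarrow>
     (\<forall>u\<in>U. \<forall>w\<in>U. \<forall>t. 0 \<le> t \<and> t \<le> 1 \<longrightarrow>
        \<omega> ((1 - t) *\<^sub>R u + t *\<^sub>R w)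
          \<le> (1 - t) * \<omega> u + t * \<omega> w - 1 / 2 * t * (1 - t) * (N (u - w))\<^sup>2)"

text \<open>The derivative is taken within \<open>U\<close>, which may have empty interior. In that case the gradient
  \<open>\<omega>'\<close> is a continuous selection; \<open>\<omega>' u \<bullet> (w - u)\<close> is nevertheless determined by \<open>\<omega>\<close> for
  \<open>u, w\<close> in the convex set \<open>U\<close>, and this is all that enters the Bregman distance.\<close>

definition dist_gen_fun ::
  "('a::real_inner \<Rightarrow> real) \<Rightarrow> 'a set \<Rightarrow> ('a \<Rightarrow> real) \<Rightarrow> ('a \<Rightarrow> 'a) \<Rightarrow> bool" where
  "dist_gen_fun N U \<omega> \<omega>' \<longleftrightarrow>
     (\<forall>u\<in>U. (\<omega> has_derivative (\<lambda>h. \<omega>' u \<bullet> h)) (at u within U)) \<and>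
     continuous_on U \<omega>' \<and> convex_on U \<omega> \<and> strongly_convex_on N U \<omega>"

definition bregman :: "('a::real_inner \<Rightarrow> real) \<Rightarrow> ('a \<Rightarrow> 'a) \<Rightarrow> 'a \<Rightarrow> 'a \<Rightarrow> real" where
  "bregman \<omega> \<omega>' u w = \<omega> w - \<omega> u - \<omega>' u \<bullet> (w - u)"

definition field_of :: "('a \<Rightarrow> 'a) \<Rightarrow> 'b \<Rightarrow> 'a \<times> 'b \<Rightarrow> 'a \<times> 'b" where
  "field_of Fu Fv = (\<lambda>(u, v). (Fu u, Fv))"

definition coercive_wrt_v :: "('a::real_normed_vector \<times> 'b::real_inner) set \<Rightarrow> 'b \<Rightarrow> bool" where
  "coercive_wrt_v X Fv \<longleftrightarrow>
     (\<forall>u v. (\<forall>t::nat. (u t, v t) \<in> X) \<and> bounded (range u) \<and>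
            filterlim (\<lambda>t. norm (v t)) at_top sequentially \<longrightarrow>
            filterlim (\<lambda>t. Fv \<bullet> v t) at_top sequentially)"

text \<open>\<open>is_prox X \<omega> \<omega>' x \<xi> z\<close>: \<open>z\<close> is one of the minimizers among which the value of the prox-mapping
  \<open>P\<^sub>x(\<xi>)\<close> is selected. The minimizer need not be unique, hence a relation.\<close>

definition is_prox ::
  "('a::real_inner \<times> 'b::real_inner) set \<Rightarrow> ('a \<Rightarrow> real) \<Rightarrow> ('a \<Rightarrow> 'a) \<Rightarrow>
   'a \<times> 'b \<Rightarrow> 'a \<times> 'b \<Rightarrow> 'a \<times> 'b \<Rightarrow> bool" where
  "is_prox X \<omega> \<omega>' x \<xi> z \<longleftrightarrow>
     is_arg_min (\<lambda>(s, w). fst \<xi> \<bullet> s + snd \<xi> \<bullet> w + bregman \<omega> \<omega>' (fst x) s) (\<lambda>z. z \<in> X) z"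

definition CoMP ::
  "('a::real_inner \<times> 'b::real_inner) set \<Rightarrow> ('a \<Rightarrow> real) \<Rightarrow> ('a \<Rightarrow> 'a) \<Rightarrow> ('a \<times> 'b \<Rightarrow> 'a \<times> 'b) \<Rightarrow>
   (nat \<Rightarrow> real) \<Rightarrow> (nat \<Rightarrow> 'a \<times> 'b) \<Rightarrow> (nat \<Rightarrow> 'a \<times> 'b) \<Rightarrow> bool" where
  "CoMP X \<omega> \<omega>' F \<gamma> x y \<longleftrightarrow>
     x 1 \<in> X \<and>
     (\<forall>\<tau>\<ge>1. is_prox X \<omega> \<omega>' (x \<tau>) (\<gamma> \<tau> *\<^sub>R F (x \<tau>)) (y \<tau>) \<and>
            is_prox X \<omega> \<omega>' (x \<tau>) (\<gamma> \<tau> *\<^sub>R F (y \<tau>)) (x (Suc \<tau>)))"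

definition comp_delta ::
  "('a::real_inner \<Rightarrow> real) \<Rightarrow> ('a \<Rightarrow> 'a) \<Rightarrow> ('a \<Rightarrow> 'a) \<Rightarrow> (nat \<Rightarrow> real) \<Rightarrow>
   (nat \<Rightarrow> 'a \<times> 'b) \<Rightarrow> (nat \<Rightarrow> 'a \<times> 'b) \<Rightarrow> nat \<Rightarrow> real" where
  "comp_delta \<omega> \<omega>' Fu \<gamma> x y \<tau> =
     (let u = fst (x \<tau>); u' = fst (y \<tau>); u_next = fst (x (Suc \<tau>)) in
        \<gamma> \<tau> * ((Fu u' - Fu u) \<bullet> (u' - u_next)) - bregman \<omega> \<omega>' u' u_next - bregman \<omega> \<omega>' u u')"

text \<open>A \<open>t\<close>-step protocol is a sequence of pairs of which only the entries \<open>1, \<dots>, t\<close> matter;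
  likewise for certificates.\<close>

definition execution_protocol :: "'e set \<Rightarrow> ('e \<Rightarrow> 'e) \<Rightarrow> nat \<Rightarrow> (nat \<Rightarrow> 'e \<times> 'e) \<Rightarrow> bool" where
  "execution_protocol X F t I \<longleftrightarrow> (\<forall>\<tau>\<in>{1..t}. fst (I \<tau>) \<in> X \<and> snd (I \<tau>) = F (fst (I \<tau>)))"

definition accuracy_certificate :: "nat \<Rightarrow> (nat \<Rightarrow> real) \<Rightarrow> bool" where
  "accuracy_certificate t lam \<longleftrightarrow> (\<forall>\<tau>\<in>{1..t}. lam \<tau> \<ge> 0) \<and> (\<Sum>\<tau>=1..t. lam \<tau>) = 1"

text \<open>The suprema below may be infinite, hence the extended reals.\<close>

definition resolution ::
  "'e::real_inner set \<Rightarrow> nat \<Rightarrow> (nat \<Rightarrow> 'e \<times> 'e) \<Rightarrow> (nat \<Rightarrow> real) \<Rightarrow> ereal" where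
  "resolution X' t I lam =
     (SUP x\<in>X'. ereal (\<Sum>\<tau>=1..t. lam \<tau> * (snd (I \<tau>) \<bullet> (fst (I \<tau>) - x))))"

definition Theta ::
  "('a::real_inner \<Rightarrow> real) \<Rightarrow> ('a \<Rightarrow> 'a) \<Rightarrow> 'a \<Rightarrow> ('a \<times> 'b) set \<Rightarrow> ereal" where
  "Theta \<omega> \<omega>' u1 X' = (SUP (u, v)\<in>X'. ereal (bregman \<omega> \<omega>' u1 u))"

end

theory Submission
  imports Defs
begin

text \<open>
  Write \<open>V(u, w)\<close> for the Bregman distance \<open>bregman \<omega> \<omega>' u w\<close>.  The proof rests on one
  inequality for a prox-step.  A minimizer \<open>(z, z')\<close> of
  \<open>\<eta> \<bullet> s + \<zeta> \<bullet> w + V(u, s)\<close> over the convex set \<open>X\<close> satisfies the first-order condition that the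
  derivative of the objective towards any \<open>(s, w) \<in> X\<close> is nonnegative, and the three-point identity
  for Bregman distances turns this condition into
  \<open>\<eta> \<bullet> (z - s) + \<zeta> \<bullet> (z' - w) \<le> V(u, s) - V(z, s) - V(u, z)\<close> (lemma \<open>prox_inequality\<close>).

  An iteration of the recurrence performs two prox-steps from the same centre \<open>x\<^sub>\<tau>\<close>.  The inequality
  of the first step is taken at the outcome \<open>x\<^bsub>\<tau>+1\<^esub>\<close> of the second, that of the second step at an
  arbitrary point of \<open>X\<close>.  Since both steps use the same constant component \<open>\<gamma>\<^sub>\<tau> F\<^sub>v\<close>, their sum
  contains this component only in the combination \<open>\<gamma>\<^sub>\<tau> F\<^sub>v \<bullet> (v'\<^sub>\<tau> - w)\<close>, and the
  mismatch of the two values \<open>F\<^sub>u(u\<^sub>\<tau>)\<close> and \<open>F\<^sub>u(u'\<^sub>\<tau>)\<close> is collected, together with the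
  Bregman distances between the iterates, in \<open>\<delta>\<^sub>\<tau>\<close> (the quantity \<open>comp_delta\<close>):
  \<open>\<gamma>\<^sub>\<tau> F(y\<^sub>\<tau>) \<bullet> (y\<^sub>\<tau> - p) \<le> V(u\<^sub>\<tau>, s) - V(u\<^bsub>\<tau>+1\<^esub>, s) + \<delta>\<^sub>\<tau>\<close> for \<open>p = (s, w) \<in> X\<close>
  (lemma \<open>CoMP_step\<close>).  Summing over \<open>\<tau>\<close> telescopes the Bregman distances; the last one is
  nonnegative and is dropped, and division by the sum of the stepsizes gives the resolution bound.

  For the sufficient conditions on the stepsizes, strong convexity with respect
  to the norm \<open>\<parallel>\<cdot>\<parallel>\<close>, which is the function \<open>N\<close>, gives
  \<open>V(u, w) \<ge> \<parallel>w - u\<parallel>\<^sup>2 / 2\<close>, so with \<open>a = \<parallel>u'\<^sub>\<tau> - u\<^sub>\<tau>\<parallel>\<close> and \<open>b = \<parallel>u'\<^sub>\<tau> - u\<^bsub>\<tau>+1\<^esub>\<parallel>\<close> the quantity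
  \<open>\<delta>\<^sub>\<tau>\<close> is at most \<open>\<gamma> (L a + M) b - b\<^sup>2 / 2 - a\<^sup>2 / 2\<close>, and what is left is to bound this quadratic
  in \<open>a\<close> and \<open>b\<close>.
\<close>

section \<open>The conjugate norm\<close>

lemma is_norm_convex_on:
  assumes "is_norm N"
  shows "convex_on UNIV N"
proof (rule convex_onI)
  fix t and x y :: 'a
  assume "0 < t" "t < (1::real)"
  then show "N ((1 - t) *\<^sub>R x + t *\<^sub>R y) \<le> (1 - t) * N x + t * N y"
    using assms unfolding is_norm_def
    by (metis abs_of_pos diff_gt_0_iff_gt)
qed auto

text \<open>The equivalence of norms in finite dimension, by compactness of the Euclidean unit sphere.\<close>

lemma is_norm_dominates_norm:
  fixes N :: "'a::euclidean_space \<Rightarrow> real"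
  assumes "is_norm N"
  obtains c where "c > 0" "\<And>x. c * norm x \<le> N x"
proof -
  have "continuous_on UNIV N"
    using convex_on_continuous[OF open_UNIV is_norm_convex_on[OF assms]] .
  then have "continuous_on (sphere 0 1) N"
    using continuous_on_subset by blast
  then obtain m where m: "m \<in> sphere 0 1" "\<And>x. x \<in> sphere 0 1 \<Longrightarrow> N m \<le> N x"
    using continuous_attains_inf[of "sphere (0::'a) 1" N] by auto
  have "N m \<ge> 0" "N m \<noteq> 0"
    using assms m(1) unfolding is_norm_def by auto
  then have "N m > 0" by simp
  moreover have "N m * norm x \<le> N x" for x
  proof (cases "x = 0")
    case False
    have "N m \<le> N ((1 / norm x) *\<^sub>R x)"
      using False by (intro m(2)) simp
    also have "\<dots> = N x / norm x"
      using assms unfolding is_norm_def by simp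
    finally show ?thesis using False by (simp add: field_simps)
  qed (use assms in \<open>simp add: is_norm_def\<close>)
  ultimately show thesis using that by blast
qed

text \<open>The equivalence of norms is what makes the supremum in the conjugate norm finite; without it
  the real-valued supremum would carry no information.\<close>

lemma inner_le_conj_norm:
  fixes N :: "'a::euclidean_space \<Rightarrow> real"
  assumes "is_norm N"
  shows "\<xi> \<bullet> x \<le> conj_norm N \<xi> * N x"
proof (cases "x = 0")
  case False
  have pos: "N x > 0"
    using assms False unfolding is_norm_def by (metis less_eq_real_def)
  obtain c where c: "c > 0" "\<And>x. c * norm x \<le> N x"
    using is_norm_dominates_norm[OF assms] by blast
  have "\<xi> \<bullet> z \<le> norm \<xi> * (1 / c)" if "N z \<le> 1" for z
  proof -
    have "norm z \<le> 1 / c"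
      using c(2)[of z] c(1) that by (simp add: field_simps)
    then show ?thesis
      by (meson norm_cauchy_schwarz mult_left_mono norm_ge_zero order_trans)
  qed
  then have bdd: "bdd_above ((\<lambda>z. \<xi> \<bullet> z) ` {z. N z \<le> 1})"
    by (intro bdd_aboveI2) auto
  have "N ((1 / N x) *\<^sub>R x) = \<bar>1 / N x\<bar> * N x"
    using assms unfolding is_norm_def by blast
  then have "N ((1 / N x) *\<^sub>R x) = 1"
    using pos by simp
  then have "\<xi> \<bullet> ((1 / N x) *\<^sub>R x) \<le> conj_norm N \<xi>"
    unfolding conj_norm_def by (intro cSUP_upper bdd) simp
  then show ?thesis using pos by (simp add: field_simps)
next
  case True
  then have "N x = 0" using assms unfolding is_norm_def by blast
  with True show ?thesis by simp
qed

section \<open>Bregman distances\<close>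

lemma bregman_three_points:
  "(\<omega>' z - \<omega>' u) \<bullet> (s - z) = bregman \<omega> \<omega>' u s - bregman \<omega> \<omega>' z s - bregman \<omega> \<omega>' u z"
  unfolding bregman_def by (simp add: inner_diff_left inner_diff_right)

text \<open>Differentiability within \<open>U\<close> is used only through these one-sided directional derivatives,
  which exist because \<open>U\<close> contains the segment from \<open>u\<close> to \<open>w\<close>.\<close>

lemma dist_gen_fun_directional_derivative:
  assumes "dist_gen_fun N U \<omega> \<omega>'" "convex U" "u \<in> U" "w \<in> U"
  shows "((\<lambda>t. (\<omega> (u + t *\<^sub>R (w - u)) - \<omega> u) / t) \<longlongrightarrow> \<omega>' u \<bullet> (w - u)) (at_right 0)"
proof -
  have seg: "(\<lambda>t. u + t *\<^sub>R (w - u)) ` {0..1} \<subseteq> U"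
    using assms(2-4) by (auto simp: convex_alt algebra_simps)
  have "(\<omega> has_derivative (\<lambda>h. \<omega>' u \<bullet> h)) (at (u + 0 *\<^sub>R (w - u)) within U)"
    using assms(1,3) unfolding dist_gen_fun_def by simp
  then have outer: "(\<omega> has_derivative (\<lambda>h. \<omega>' u \<bullet> h))
      (at (u + 0 *\<^sub>R (w - u)) within (\<lambda>t. u + t *\<^sub>R (w - u)) ` {0..1})"
    using seg has_derivative_subset by blast
  have "((\<lambda>t. u + t *\<^sub>R (w - u)) has_derivative (\<lambda>t. t *\<^sub>R (w - u))) (at 0 within {0..1})"
    by (auto intro!: derivative_eq_intros)
  from has_derivative_in_compose[OF this outer]
  have "((\<lambda>t. \<omega> (u + t *\<^sub>R (w - u))) has_derivative (\<lambda>t. (\<omega>' u \<bullet> (w - u)) * t))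
      (at 0 within {0..1})"
    by (simp add: mult.commute)
  then have "((\<lambda>t. \<omega> (u + t *\<^sub>R (w - u))) has_field_derivative \<omega>' u \<bullet> (w - u))
      (at 0 within {0..1})"
    by (simp add: has_field_derivative_def)
  then show ?thesis
    by (simp add: has_field_derivative_iff at_within_Icc_at_right)
qed

text \<open>Strong convexity on the segment bounds the difference quotient at \<open>t\<close> by
  \<open>\<omega> w - \<omega> u - (1 - t) \<parallel>u - w\<parallel>\<^sup>2 / 2\<close>; the claim is the limit of this as \<open>t\<close> tends to 0.\<close>

lemma bregman_ge_half_square:
  assumes "dist_gen_fun N U \<omega> \<omega>'" "convex U" "u \<in> U" "w \<in> U"
  shows "(N (u - w))\<^sup>2 / 2 \<le> bregman \<omega> \<omega>' u w"
proof -
  define q where "q = (\<lambda>t. \<omega> w - \<omega> u - (1 - t) * ((N (u - w))\<^sup>2 / 2))"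
  have "eventually (\<lambda>t. (\<omega> (u + t *\<^sub>R (w - u)) - \<omega> u) / t \<le> q t) (at_right 0)"
    unfolding eventually_at_right_field
  proof (intro exI[of _ 1] conjI allI impI)
    fix t :: real
    assume t: "0 < t" "t < 1"
    have "(1 - t) *\<^sub>R u + t *\<^sub>R w = u + t *\<^sub>R (w - u)"
      by (simp add: algebra_simps)
    moreover have "\<omega> ((1 - t) *\<^sub>R u + t *\<^sub>R w)
        \<le> (1 - t) * \<omega> u + t * \<omega> w - 1 / 2 * t * (1 - t) * (N (u - w))\<^sup>2"
      using assms t unfolding dist_gen_fun_def strongly_convex_on_def by auto
    ultimately have "\<omega> (u + t *\<^sub>R (w - u)) - \<omega> u \<le> q t * t"
      unfolding q_def by (simp add: algebra_simps)
    then show "(\<omega> (u + t *\<^sub>R (w - u)) - \<omega> u) / t \<le> q t"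
      using t by (simp add: field_simps)
  qed simp
  moreover have "(q \<longlongrightarrow> q 0) (at_right 0)"
    unfolding q_def by (intro tendsto_intros)
  ultimately have "\<omega>' u \<bullet> (w - u) \<le> q 0"
    using dist_gen_fun_directional_derivative[OF assms]
    by (intro tendsto_le[OF trivial_limit_at_right_real])
  then show ?thesis unfolding q_def bregman_def by simp
qed

section \<open>The prox-mapping and one iteration\<close>

text \<open>Minimality is compared along the segment from \<open>z\<close> to \<open>p\<close>; in the limit the difference
  quotient of the objective becomes the first-order optimality condition, and the three-point
  identity rewrites it in terms of Bregman distances.\<close>

lemma prox_inequality:
  fixes X :: "('a::real_inner \<times> 'b::real_inner) set"
  assumes dgf: "dist_gen_fun N U \<omega> \<omega>'" and "convex U" "convex X" "fst ` X \<subseteq> U"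
    and prox: "is_prox X \<omega> \<omega>' c \<xi> z" and p: "p \<in> X"
  shows "\<xi> \<bullet> (z - p) \<le> bregman \<omega> \<omega>' (fst c) (fst p) - bregman \<omega> \<omega>' (fst z) (fst p)
      - bregman \<omega> \<omega>' (fst c) (fst z)"
proof -
  define k where "k = \<xi> \<bullet> (p - z) - \<omega>' (fst c) \<bullet> (fst p - fst z)"
  have z: "z \<in> X"
    using prox unfolding is_prox_def is_arg_min_def by simp
  have min: "\<xi> \<bullet> z + bregman \<omega> \<omega>' (fst c) (fst z) \<le> \<xi> \<bullet> r + bregman \<omega> \<omega>' (fst c) (fst r)"
    if "r \<in> X" for r
    using prox that unfolding is_prox_def is_arg_min_linorder
    by (auto simp: inner_prod_def split_beta)
  have "eventually (\<lambda>t. - k \<le> (\<omega> (fst z + t *\<^sub>R (fst p - fst z)) - \<omega> (fst z)) / t) (at_right 0)"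
    unfolding eventually_at_right_field
  proof (intro exI[of _ 1] conjI allI impI)
    fix t :: real
    assume t: "0 < t" "t < 1"
    have "z + t *\<^sub>R (p - z) = (1 - t) *\<^sub>R z + t *\<^sub>R p"
      by (simp add: algebra_simps)
    then have "z + t *\<^sub>R (p - z) \<in> X"
      using \<open>convex X\<close> z p t by (simp add: convex_alt)
    from min[OF this]
    have "- k * t \<le> \<omega> (fst z + t *\<^sub>R (fst p - fst z)) - \<omega> (fst z)"
      unfolding bregman_def k_def by (simp add: algebra_simps inner_add_right inner_diff_right)
    then show "- k \<le> (\<omega> (fst z + t *\<^sub>R (fst p - fst z)) - \<omega> (fst z)) / t"
      using t by (simp add: field_simps)
  qed simp
  moreover have "fst z \<in> U" "fst p \<in> U"
    using z p \<open>fst ` X \<subseteq> U\<close> by auto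
  ultimately have "- k \<le> \<omega>' (fst z) \<bullet> (fst p - fst z)"
    using dist_gen_fun_directional_derivative[OF dgf \<open>convex U\<close>]
    by (intro tendsto_lowerbound[OF _ _ trivial_limit_at_right_real])
  then have "\<xi> \<bullet> (z - p) \<le> (\<omega>' (fst z) - \<omega>' (fst c)) \<bullet> (fst p - fst z)"
    unfolding k_def by (simp add: inner_diff_left inner_diff_right)
  then show ?thesis
    by (simp only: bregman_three_points[where \<omega> = \<omega>])
qed

lemma CoMP_in_domain:
  assumes "CoMP X \<omega> \<omega>' F \<gamma> x y" "\<tau> \<ge> 1"
  shows "x \<tau> \<in> X" "y \<tau> \<in> X"
proof -
  have "x \<tau> \<in> X \<and> y \<tau> \<in> X"
    using assms(2)
  proof (induction \<tau> rule: dec_induct)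
    case base
    then show ?case
      using assms(1) unfolding CoMP_def is_prox_def is_arg_min_def by auto
  next
    case (step n)
    moreover have "Suc n \<ge> 1" by simp
    ultimately show ?case
      using assms(1) unfolding CoMP_def is_prox_def is_arg_min_def by blast
  qed
  then show "x \<tau> \<in> X" "y \<tau> \<in> X" by auto
qed

lemma CoMP_step:
  fixes X :: "('a::real_inner \<times> 'b::real_inner) set"
  assumes "dist_gen_fun N U \<omega> \<omega>'" "convex U" "convex X" "fst ` X \<subseteq> U"
    and rec: "CoMP X \<omega> \<omega>' (field_of Fu Fv) \<gamma> x y" and \<tau>: "\<tau> \<ge> 1" and p: "p \<in> X"
  shows "\<gamma> \<tau> * (field_of Fu Fv (y \<tau>) \<bullet> (y \<tau> - p))
      \<le> bregman \<omega> \<omega>' (fst (x \<tau>)) (fst p) - bregman \<omega> \<omega>' (fst (x (Suc \<tau>))) (fst p)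
        + comp_delta \<omega> \<omega>' Fu \<gamma> x y \<tau>"
proof -
  let ?F = "field_of Fu Fv" and ?V = "bregman \<omega> \<omega>'"
  note prox = prox_inequality[OF assms(1-4)]
  have steps: "is_prox X \<omega> \<omega>' (x \<tau>) (\<gamma> \<tau> *\<^sub>R ?F (x \<tau>)) (y \<tau>)"
    "is_prox X \<omega> \<omega>' (x \<tau>) (\<gamma> \<tau> *\<^sub>R ?F (y \<tau>)) (x (Suc \<tau>))"
    using rec \<tau> unfolding CoMP_def by auto
  have "x (Suc \<tau>) \<in> X"
    using CoMP_in_domain(1)[OF rec] by simp
  from prox[OF steps(1) this]
  have 1: "\<gamma> \<tau> * (?F (x \<tau>) \<bullet> (y \<tau> - x (Suc \<tau>)))
      \<le> ?V (fst (x \<tau>)) (fst (x (Suc \<tau>))) - ?V (fst (y \<tau>)) (fst (x (Suc \<tau>)))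
        - ?V (fst (x \<tau>)) (fst (y \<tau>))"
    by simp
  from prox[OF steps(2) p]
  have 2: "\<gamma> \<tau> * (?F (y \<tau>) \<bullet> (x (Suc \<tau>) - p))
      \<le> ?V (fst (x \<tau>)) (fst p) - ?V (fst (x (Suc \<tau>))) (fst p)
        - ?V (fst (x \<tau>)) (fst (x (Suc \<tau>)))"
    by simp
  \<comment> \<open>The two field values differ only in their first component, so \<open>F\<^sub>v\<close> cancels here.\<close>
  have "(?F (y \<tau>) - ?F (x \<tau>)) \<bullet> (y \<tau> - x (Suc \<tau>))
      = (Fu (fst (y \<tau>)) - Fu (fst (x \<tau>))) \<bullet> (fst (y \<tau>) - fst (x (Suc \<tau>)))"
    by (simp add: field_of_def split_beta inner_prod_def)
  then have 3: "comp_delta \<omega> \<omega>' Fu \<gamma> x y \<tau>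
      = \<gamma> \<tau> * ((?F (y \<tau>) - ?F (x \<tau>)) \<bullet> (y \<tau> - x (Suc \<tau>)))
        - ?V (fst (y \<tau>)) (fst (x (Suc \<tau>))) - ?V (fst (x \<tau>)) (fst (y \<tau>))"
    unfolding comp_delta_def Let_def by simp
  have "\<gamma> \<tau> * (?F (y \<tau>) \<bullet> (y \<tau> - p))
      = \<gamma> \<tau> * ((?F (y \<tau>) - ?F (x \<tau>)) \<bullet> (y \<tau> - x (Suc \<tau>)))
        + \<gamma> \<tau> * (?F (x \<tau>) \<bullet> (y \<tau> - x (Suc \<tau>)))
        + \<gamma> \<tau> * (?F (y \<tau>) \<bullet> (x (Suc \<tau>) - p))"
    by (simp add: inner_diff_left inner_diff_right algebra_simps)
  then show ?thesis
    using 1 2 3 by linarith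
qed

section \<open>Admissible stepsizes\<close>

text \<open>Completing squares: the sum of \<open>(k b - a)\<^sup>2 / 2\<close>, \<open>(b / 2 - m)\<^sup>2\<close> and
  \<open>(1 / 2 - k\<^sup>2) b\<^sup>2 / 2\<close> is the difference of the two sides.\<close>

lemma quadratic_bound:
  fixes a b k m :: real
  assumes "k\<^sup>2 \<le> 1 / 2"
  shows "(k * a + m) * b - b\<^sup>2 / 2 - a\<^sup>2 / 2 \<le> m\<^sup>2"
proof -
  have "0 \<le> (1 / 2 - k\<^sup>2) * b\<^sup>2 / 2" using assms by simp
  moreover have "m\<^sup>2 - ((k * a + m) * b - b\<^sup>2 / 2 - a\<^sup>2 / 2)
      = (k * b - a)\<^sup>2 / 2 + (b / 2 - m)\<^sup>2 + (1 / 2 - k\<^sup>2) * b\<^sup>2 / 2"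
    by (simp add: power2_eq_square field_simps)
  ultimately show ?thesis
    using zero_le_power2[of "k * b - a"] zero_le_power2[of "b / 2 - m"] by linarith
qed

text \<open>For \<open>m = 0\<close> no part of \<open>b\<^sup>2 / 2\<close> has to be spent on the linear term, so \<open>k\<close> may reach 1.\<close>

lemma quadratic_bound_0:
  fixes a b k :: real
  assumes "k\<^sup>2 \<le> 1"
  shows "k * a * b - b\<^sup>2 / 2 - a\<^sup>2 / 2 \<le> 0"
proof -
  have "0 \<le> (1 - k\<^sup>2) * b\<^sup>2 / 2" using assms by simp
  moreover have "- (k * a * b - b\<^sup>2 / 2 - a\<^sup>2 / 2) = (k * b - a)\<^sup>2 / 2 + (1 - k\<^sup>2) * b\<^sup>2 / 2"
    by (simp add: power2_eq_square field_simps)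
  ultimately show ?thesis
    using zero_le_power2[of "k * b - a"] by linarith
qed

text \<open>The product form also covers \<open>c = 0\<close>, where the extended-real inverse is infinite and every
  stepsize is admissible.\<close>

lemma ereal_le_inverse_iff:
  assumes "c \<ge> 0"
  shows "ereal g \<le> inverse (ereal c) \<longleftrightarrow> g * c \<le> 1"
proof (cases "c = 0")
  case False
  with assms show ?thesis by (simp add: field_simps)
qed simp

lemma neg_bregman_sum_le:
  assumes "is_norm N" "dist_gen_fun N U \<omega> \<omega>'" "convex U" "u \<in> U" "u' \<in> U" "w \<in> U"
  shows "- bregman \<omega> \<omega>' u' w - bregman \<omega> \<omega>' u u' \<le> - (N (u' - w))\<^sup>2 / 2 - (N (u' - u))\<^sup>2 / 2"
proof -
  have "N (u - u') = N (u' - u)"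
    using assms(1) unfolding is_norm_def
    by (metis abs_minus_cancel abs_one minus_diff_eq mult_1 scaleR_minus1_left)
  then show ?thesis
    using bregman_ge_half_square[OF assms(2,3,5,6)] bregman_ge_half_square[OF assms(2-5)] by simp
qed


theorem theorem3p1:
  fixes N :: "'a::euclidean_space \<Rightarrow> real"
    and U :: "'a set"
    and X :: "('a \<times> 'b::euclidean_space) set"
    and \<omega> :: "'a \<Rightarrow> real" and \<omega>' :: "'a \<Rightarrow> 'a"
    and Fu :: "'a \<Rightarrow> 'a" and Fv :: 'b
    and L M :: real
    and \<gamma> :: "nat \<Rightarrow> real"
    and x y :: "nat \<Rightarrow> 'a \<times> 'b"
  assumes U: "U \<noteq> {}" "closed U" "convex U"
    and X: "X \<noteq> {}" "closed X" "convex X"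
    and A1: "is_norm N" "dist_gen_fun N U \<omega> \<omega>'"
    and A2: "\<And>u v. (u, v) \<in> X \<Longrightarrow> u \<in> U"
    and A3: "L \<ge> 0" "M \<ge> 0"
      "\<And>u u'. u \<in> U \<Longrightarrow> u' \<in> U \<Longrightarrow> conj_norm N (Fu u - Fu u') \<le> L * N (u - u') + M"
    and A4: "\<exists>c. \<forall>(u, v)\<in>X. c \<le> Fv \<bullet> v" "coercive_wrt_v X Fv"
    and gamma_pos: "\<And>\<tau>. \<tau> \<ge> 1 \<Longrightarrow> \<gamma> \<tau> > 0"
    and recurrence: "CoMP X \<omega> \<omega>' (field_of Fu Fv) \<gamma> x y"
  shows
    "((\<forall>\<tau>\<ge>1. comp_delta \<omega> \<omega>' Fu \<gamma> x y \<tau> \<le> (\<gamma> \<tau>)\<^sup>2 * M\<^sup>2) \<longrightarrow>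
       (\<forall>t\<ge>1.
          let I = (\<lambda>\<tau>. (y \<tau>, field_of Fu Fv (y \<tau>)));
              lam = (\<lambda>\<tau>. \<gamma> \<tau> / (\<Sum>i=1..t. \<gamma> i))
          in execution_protocol X (field_of Fu Fv) t I \<and>
             accuracy_certificate t lam \<and>
             (\<forall>X'. X' \<subseteq> X \<and> X' \<noteq> {} \<longrightarrow>
                resolution X' t I lam
                  \<le> (Theta \<omega> \<omega>' (fst (x 1)) X' + ereal (M\<^sup>2 * (\<Sum>\<tau>=1..t. (\<gamma> \<tau>)\<^sup>2)))
                     / ereal (\<Sum>\<tau>=1..t. \<gamma> \<tau>))))
     \<and> (\<forall>\<tau>\<ge>1. ereal (\<gamma> \<tau>) \<le> inverse (ereal (sqrt 2 * L)) \<or>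
               (M = 0 \<and> ereal (\<gamma> \<tau>) \<le> inverse (ereal L)) \<longrightarrow>
               comp_delta \<omega> \<omega>' Fu \<gamma> x y \<tau> \<le> (\<gamma> \<tau>)\<^sup>2 * M\<^sup>2)"
proof (intro conjI impI allI)
  let ?F = "field_of Fu Fv" and ?V = "bregman \<omega> \<omega>'"
  have sub: "fst ` X \<subseteq> U"
    using A2 by auto
  note dom = CoMP_in_domain[OF recurrence]
  have inU: "fst (x \<tau>) \<in> U" "fst (y \<tau>) \<in> U" if "\<tau> \<ge> 1" for \<tau>
    using dom[OF that] sub by auto
  {
    fix t :: nat
    assume delta: "\<forall>\<tau>\<ge>1. comp_delta \<omega> \<omega>' Fu \<gamma> x y \<tau> \<le> (\<gamma> \<tau>)\<^sup>2 * M\<^sup>2" and t: "t \<ge> 1"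
    define G where "G = (\<Sum>i=1..t. \<gamma> i)"
    define B where "B = M\<^sup>2 * (\<Sum>\<tau>=1..t. (\<gamma> \<tau>)\<^sup>2)"
    have G: "G > 0"
      unfolding G_def using t gamma_pos by (intro sum_pos) auto
    have bound: "(\<Sum>\<tau>=1..t. \<gamma> \<tau> / G * (?F (y \<tau>) \<bullet> (y \<tau> - p))) \<le> (?V (fst (x 1)) (fst p) + B) / G"
      if p: "p \<in> X" for p
    proof -
      let ?D = "\<lambda>\<tau>. ?V (fst (x \<tau>)) (fst p)"
      have "(\<Sum>\<tau>=1..t. \<gamma> \<tau> * (?F (y \<tau>) \<bullet> (y \<tau> - p)))
          \<le> (\<Sum>\<tau>=1..t. (?D \<tau> - ?D (Suc \<tau>)) + M\<^sup>2 * (\<gamma> \<tau>)\<^sup>2)"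
      proof (rule sum_mono)
        fix \<tau> assume "\<tau> \<in> {1..t}"
        then have \<tau>: "\<tau> \<ge> 1" by simp
        show "\<gamma> \<tau> * (?F (y \<tau>) \<bullet> (y \<tau> - p)) \<le> (?D \<tau> - ?D (Suc \<tau>)) + M\<^sup>2 * (\<gamma> \<tau>)\<^sup>2"
          using CoMP_step[OF A1(2) U(3) X(3) sub recurrence \<tau> p] delta[rule_format, OF \<tau>]
          by (simp only: mult.commute[of "M\<^sup>2"])
      qed
      also have "\<dots> = ?D 1 - ?D (Suc t) + B"
      proof -
        have "(\<Sum>\<tau>=1..t. ?D \<tau> - ?D (Suc \<tau>)) = ?D 1 - ?D (Suc t)"
          by (induction t) auto
        then show ?thesis by (simp only: sum.distrib B_def sum_distrib_left)
      qed
      also have "\<dots> \<le> ?D 1 + B"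
      proof -
        have "0 \<le> (N (fst (x (Suc t)) - fst p))\<^sup>2 / 2" by simp
        also have "\<dots> \<le> ?D (Suc t)"
          using inU(1)[of "Suc t"] p sub by (intro bregman_ge_half_square[OF A1(2) U(3)]) auto
        finally show ?thesis by simp
      qed
      finally have "(\<Sum>\<tau>=1..t. \<gamma> \<tau> * (?F (y \<tau>) \<bullet> (y \<tau> - p))) / G \<le> (?D 1 + B) / G"
        using G by (intro divide_right_mono) auto
      then show ?thesis by (simp add: sum_divide_distrib)
    qed
    have "execution_protocol X ?F t (\<lambda>\<tau>. (y \<tau>, ?F (y \<tau>)))"
      unfolding execution_protocol_def using dom by simp
    moreover have "accuracy_certificate t (\<lambda>\<tau>. \<gamma> \<tau> / G)"
      unfolding accuracy_certificate_def using G gamma_pos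
      by (auto simp flip: sum_divide_distrib simp: G_def less_imp_le)
    moreover have "resolution X' t (\<lambda>\<tau>. (y \<tau>, ?F (y \<tau>))) (\<lambda>\<tau>. \<gamma> \<tau> / G)
        \<le> (Theta \<omega> \<omega>' (fst (x 1)) X' + ereal B) / ereal G" if "X' \<subseteq> X" for X'
      unfolding resolution_def
    proof (rule SUP_least)
      fix p assume p: "p \<in> X'"
      have "ereal (?V (fst (x 1)) (fst p)) \<le> Theta \<omega> \<omega>' (fst (x 1)) X'"
        unfolding Theta_def using SUP_upper[OF p, of "\<lambda>(u, v). ereal (?V (fst (x 1)) u)"]
        by (simp add: split_beta)
      then have "(ereal (?V (fst (x 1)) (fst p)) + ereal B) / ereal G
          \<le> (Theta \<omega> \<omega>' (fst (x 1)) X' + ereal B) / ereal G"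
        using G by (intro ereal_divide_right_mono add_right_mono) auto
      moreover have "ereal (\<Sum>\<tau>=1..t. \<gamma> \<tau> / G * (?F (y \<tau>) \<bullet> (y \<tau> - p)))
          \<le> (ereal (?V (fst (x 1)) (fst p)) + ereal B) / ereal G"
        using bound[OF subsetD[OF that p]] G by simp
      ultimately show "ereal (\<Sum>\<tau>=1..t. \<gamma> \<tau> / G *
          (snd (y \<tau>, ?F (y \<tau>)) \<bullet> (fst (y \<tau>, ?F (y \<tau>)) - p)))
          \<le> (Theta \<omega> \<omega>' (fst (x 1)) X' + ereal B) / ereal G"
        by simp
    qed
    ultimately show "let I = (\<lambda>\<tau>. (y \<tau>, ?F (y \<tau>))); lam = (\<lambda>\<tau>. \<gamma> \<tau> / (\<Sum>i=1..t. \<gamma> i))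
          in execution_protocol X ?F t I \<and> accuracy_certificate t lam \<and>
             (\<forall>X'. X' \<subseteq> X \<and> X' \<noteq> {} \<longrightarrow>
                resolution X' t I lam
                  \<le> (Theta \<omega> \<omega>' (fst (x 1)) X' + ereal (M\<^sup>2 * (\<Sum>\<tau>=1..t. (\<gamma> \<tau>)\<^sup>2)))
                     / ereal (\<Sum>\<tau>=1..t. \<gamma> \<tau>))"
      unfolding G_def B_def Let_def by blast
  }
  fix \<tau> :: nat
  assume \<tau>: "\<tau> \<ge> 1" and step: "ereal (\<gamma> \<tau>) \<le> inverse (ereal (sqrt 2 * L)) \<or>
      (M = 0 \<and> ereal (\<gamma> \<tau>) \<le> inverse (ereal L))"
  define u u' w where "u = fst (x \<tau>)" and "u' = fst (y \<tau>)" and "w = fst (x (Suc \<tau>))"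
  define a b where "a = N (u' - u)" and "b = N (u' - w)"
  have mem: "u \<in> U" "u' \<in> U" "w \<in> U"
    unfolding u_def u'_def w_def using inU[OF \<tau>] inU(1)[of "Suc \<tau>"] by auto
  have pos: "\<gamma> \<tau> > 0" "b \<ge> 0"
    using gamma_pos \<tau> A1(1) unfolding b_def is_norm_def by auto
  have "(Fu u' - Fu u) \<bullet> (u' - w) \<le> conj_norm N (Fu u' - Fu u) * b"
    unfolding b_def by (rule inner_le_conj_norm[OF A1(1)])
  also have "\<dots> \<le> (L * a + M) * b"
    unfolding a_def using A3(3) mem pos by (intro mult_right_mono) auto
  finally have "\<gamma> \<tau> * ((Fu u' - Fu u) \<bullet> (u' - w)) \<le> \<gamma> \<tau> * ((L * a + M) * b)"
    using pos by (intro mult_left_mono) auto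
  then have main: "comp_delta \<omega> \<omega>' Fu \<gamma> x y \<tau>
      \<le> (\<gamma> \<tau> * L * a + \<gamma> \<tau> * M) * b - b\<^sup>2 / 2 - a\<^sup>2 / 2"
    using neg_bregman_sum_le[OF A1 U(3) mem]
    unfolding comp_delta_def Let_def a_def b_def u_def u'_def w_def by (simp add: algebra_simps)
  have nonneg: "0 \<le> \<gamma> \<tau> * L"
    using pos A3(1) by simp
  from step show "comp_delta \<omega> \<omega>' Fu \<gamma> x y \<tau> \<le> (\<gamma> \<tau>)\<^sup>2 * M\<^sup>2"
  proof
    assume "ereal (\<gamma> \<tau>) \<le> inverse (ereal (sqrt 2 * L))"
    then have "sqrt 2 * (\<gamma> \<tau> * L) \<le> 1"
      using A3(1) by (subst (asm) ereal_le_inverse_iff) (auto simp: mult_ac)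
    then have "(sqrt 2 * (\<gamma> \<tau> * L))\<^sup>2 \<le> 1"
      using nonneg by (intro power_le_one) auto
    then have "(\<gamma> \<tau> * L)\<^sup>2 \<le> 1 / 2"
      by (simp add: power_mult_distrib)
    from quadratic_bound[OF this, of a "\<gamma> \<tau> * M" b] main show ?thesis
      by (simp add: power_mult_distrib)
  next
    assume "M = 0 \<and> ereal (\<gamma> \<tau>) \<le> inverse (ereal L)"
    then have M: "M = 0" and "\<gamma> \<tau> * L \<le> 1"
      using ereal_le_inverse_iff[OF A3(1)] by auto
    then have "(\<gamma> \<tau> * L)\<^sup>2 \<le> 1"
      using nonneg by (intro power_le_one) auto
    from quadratic_bound_0[OF this, of a b] main M show ?thesis
      by simp
  qed
qed

end
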